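(* Let $\mathcal{A}=\{\alpha_1,\alpha_2\}\subseteq\mathbb{R}$ with $\alpha_1\neq\alpha_2$, let $\mathcal{B}\subseteq\operatorname{conv}(\mathcal{A})\setminus\mathcal{A}$ be a nonempty finite set, and let $X\subseteq\mathbb{R}$ be nonempty and convex. Let $f=c_{\alpha_1}\mathrm{e}^{\alpha_1}+c_{\alpha_2}\mathrm{e}^{\alpha_2}+\sum_{\beta\in\mathcal{B}}d_\beta\mathrm{e}^{\beta}$ with $c_\alpha>0$ for $\alpha\in\mathcal{A}$ and $d_\beta<0$ for $\beta\in\mathcal{B}$. Then $f$ is nonnegative on $X$ if and only if there is a decomposition \[ f=\sum_{\beta\in\mathcal{B}}f_\beta,\qquad f_\beta=\sum_{\alpha\in\mathcal{A}}c^{(\beta)}_\alpha\mathrm{e}^{\alpha}+d_\beta\mathrm{e}^{\beta}, \] with $c^{(\beta)}_\alpha\ge 0$ for all $\alpha\in\mathcal{A},\beta\in\mathcal{B}$ and each $f_\beta$ nonnegative on $X$. Hence $f$ is nonnegative on $X$ if and only if $f\in C_X(\mathcal{A},\mathcal{B})$.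
   Context: For $\alpha\in\mathbb{R}$, $\mathrm{e}^{\alpha}$ denotes the function $x\mapsto\exp(\alpha x)$. For a finite set $\mathcal{A}$, a point $\beta$ and a set $X$, $C_X(\mathcal{A},\beta)$ is the set of signomials $\sum_{\alpha\in\mathcal{A}}c_\alpha\mathrm{e}^{\alpha}+d\,\mathrm{e}^{\beta}$ with $c_\alpha\ge0$ for all $\alpha$, $d\in\mathbb{R}$, which are nonnegative on $X$; for a finite set $\mathcal{B}$, $C_X(\mathcal{A},\mathcal{B})=\sum_{\beta\in\mathcal{B}}C_X(\mathcal{A},\beta)$ (Minkowski sum), the signed $X$-SAGE cone. *)

theory Defs
  imports "HOL-Analysis.Convex" "HOL-Library.Set_Algebras" "HOL-Library.Function_Algebras"
begin

definition expfun :: "real \<Rightarrow> real \<Rightarrow> real" where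
  "expfun \<alpha> = (\<lambda>x. exp (\<alpha> * x))"

definition nonneg_on :: "real set \<Rightarrow> (real \<Rightarrow> real) \<Rightarrow> bool" where
  "nonneg_on X f \<longleftrightarrow> (\<forall>x\<in>X. 0 \<le> f x)"

text \<open>Signomials are functions on the whole real line; only nonnegativity is relative to \<open>X\<close>.\<close>

definition sage_single :: "real set \<Rightarrow> real set \<Rightarrow> real \<Rightarrow> (real \<Rightarrow> real) set" where
  "sage_single X A \<beta> =
    {f. \<exists>c d. (\<forall>\<alpha>\<in>A. 0 \<le> c \<alpha>)
            \<and> f = (\<lambda>x. (\<Sum>\<alpha>\<in>A. c \<alpha> * expfun \<alpha> x) + d * expfun \<beta> x)
            \<and> nonneg_on X f}"

text \<open>The sum is the Minkowski sum of \<^theory>\<open>HOL-Library.Set_Algebras\<close>, over pointwise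
  addition of functions.\<close>

definition signed_sage_cone :: "real set \<Rightarrow> real set \<Rightarrow> real set \<Rightarrow> (real \<Rightarrow> real) set" where
  "signed_sage_cone X A B = (\<Sum>\<beta>\<in>B. sage_single X A \<beta>)"

end

theory Submission
  imports Defs "HOL-Analysis.Convex_Euclidean_Space"
begin

text \<open>Write \<open>l\<close> for the part of \<open>f\<close> supported on \<open>\<A>\<close> and \<open>h = l - f\<close>. The quotient \<open>h / l\<close> is
  continuous, positive and vanishes at infinity, so it attains its maximum \<open>q\<close> over the closure
  of \<open>X\<close> at some point \<open>p\<close>; nonnegativity of \<open>f\<close> means \<open>q \<le> 1\<close>. Enlarging \<open>h\<close> to \<open>h / q\<close> we may
  assume \<open>l - h \<ge> 0\<close> on the closure with equality at \<open>p\<close>. Translate \<open>p\<close> to the origin. Then the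
  weights satisfy \<open>c\<^sub>1 + c\<^sub>2 = \<Sum> w\<^sub>\<beta>\<close>, and we look for
  \<open>f\<^sub>\<beta> = w\<^sub>\<beta> (\<lambda>\<^sub>\<beta> e\<^bsup>\<alpha>\<^sub>1\<^esup> + (1 - \<lambda>\<^sub>\<beta>) e\<^bsup>\<alpha>\<^sub>2\<^esup> - e\<^bsup>\<beta>\<^esup>)\<close> with \<open>\<Sum> w\<^sub>\<beta> \<lambda>\<^sub>\<beta> = c\<^sub>1\<close>. If
  \<open>\<mu>\<^sub>\<beta>\<close> denotes the barycentric coordinate of \<open>\<beta>\<close>, then \<open>\<lambda>\<^sub>\<beta> = \<mu>\<^sub>\<beta>\<close> gives a globally nonnegative
  function, and smaller (larger) \<open>\<lambda>\<^sub>\<beta>\<close> one that is nonnegative to the right (left) of the origin.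
  If \<open>f' \<ge> 0\<close> at the origin, then scaling all \<open>\<mu>\<^sub>\<beta>\<close> by a common factor at most \<open>1\<close> works, and \<open>X\<close>
  lies to the right of the origin unless the factor is \<open>1\<close>; if \<open>f' \<le> 0\<close>, scale \<open>1 - \<mu>\<^sub>\<beta>\<close> instead.\<close>

section \<open>Convexity bounds for a single exponential\<close>

lemma exp_le_barycentric:
  fixes a b s y :: real
  assumes "a < b" "a \<le> s" "s \<le> b"
  shows "exp (s * y) \<le> (b - s) / (b - a) * exp (a * y) + (s - a) / (b - a) * exp (b * y)"
proof -
  define t where "t = (s - a) / (b - a)"
  have t: "0 \<le> t" "t \<le> 1" and t': "1 - t = (b - s) / (b - a)"
    using assms by (auto simp: t_def field_simps)
  have "t * (b - a) = s - a" using assms by (simp add: t_def)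
  then have s: "s * y = (1 - t) * (a * y) + t * (b * y)" by algebra
  have "exp ((1 - t) *\<^sub>R (a * y) + t *\<^sub>R (b * y)) \<le> (1 - t) * exp (a * y) + t * exp (b * y)"
    by (rule convex_onD[OF exp_convex]) (use t in auto)
  then show ?thesis using s t' by (simp add: t_def)
qed

text \<open>Replacing the barycentric weight \<open>u\<close> of \<open>a\<close> by
  \<open>l\<close> raises the right-hand side by
  \<open>(u - l) * (exp (b * y) - exp (a * y))\<close>. Since \<open>a < b\<close>, the second
  factor has the sign of \<open>y\<close>, so the last hypothesis makes this change
  nonnegative.\<close>

lemma exp_le_split:
  fixes a b s y l :: real
  assumes "a < b" "a \<le> s" "s \<le> b" "0 \<le> (y::real) * ((b - s) / (b - a) - l)"
  shows "exp (s * y) \<le> l * exp (a * y) + (1 - l) * exp (b * y)"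
proof -
  define u where "u = (b - s) / (b - a)"
  have u: "(s - a) / (b - a) = 1 - u" using assms by (simp add: u_def field_simps)
  have "0 \<le> (u - l) * (exp (b * y) - exp (a * y))"
  proof (cases "y = 0")
    case False
    show ?thesis
    proof (cases "0 < y")
      case True
      then have "0 \<le> u - l" using assms(4) by (simp add: u_def zero_le_mult_iff)
      moreover have "a * y \<le> b * y" using True assms(1) by simp
      ultimately show ?thesis by (intro mult_nonneg_nonneg) auto
    next
      assume "\<not> 0 < y"
      with False have y: "y < 0" by simp
      then have "u - l \<le> 0" using assms(4) by (simp add: u_def zero_le_mult_iff)
      moreover have "b * y \<le> a * y" using y assms(1) by simp
      ultimately show ?thesis by (intro mult_nonpos_nonpos) auto
    qed
  qed simp
  then show ?thesis
    using exp_le_barycentric[OF assms(1-3), of y] unfolding u u_def[symmetric]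
    by (simp add: algebra_simps)
qed

section \<open>The tight case: equality at a point of \<open>X\<close>\<close>

lemma sage_decomposition_tight:
  fixes a1 a2 c1 c2 p :: real and b :: "real \<Rightarrow> real" and B X :: "real set"
  assumes a: "a1 < a2" and B: "finite B" "B \<noteq> {}" "\<And>s. s \<in> B \<Longrightarrow> a1 < s \<and> s < a2"
    and b: "\<And>s. s \<in> B \<Longrightarrow> 0 < b s" and c: "0 < c1" "0 < c2"
    and X: "convex X" "p \<in> X"
    and le: "\<And>x. x \<in> X \<Longrightarrow> (\<Sum>s\<in>B. b s * exp (s * x)) \<le> c1 * exp (a1 * x) + c2 * exp (a2 * x)"
    and eq: "(\<Sum>s\<in>B. b s * exp (s * p)) = c1 * exp (a1 * p) + c2 * exp (a2 * p)"
  obtains C1 C2 :: "real \<Rightarrow> real"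
  where "\<And>s. s \<in> B \<Longrightarrow> 0 \<le> C1 s" "\<And>s. s \<in> B \<Longrightarrow> 0 \<le> C2 s" "sum C1 B = c1" "sum C2 B = c2"
    "\<And>s x. s \<in> B \<Longrightarrow> x \<in> X \<Longrightarrow> b s * exp (s * x) \<le> C1 s * exp (a1 * x) + C2 s * exp (a2 * x)"
proof -
  define F where "F x = c1 * exp (a1 * x) + c2 * exp (a2 * x) - (\<Sum>s\<in>B. b s * exp (s * x))" for x
  \<comment> \<open>Coefficients after moving \<open>p\<close> to the origin:
    \<open>b s * exp (s * x) = w s * exp (s * (x - p))\<close>, and likewise \<open>k1\<close>,
    \<open>k2\<close>. \<open>M\<close> is the mass that the barycentric weights \<open>u\<close>
    send to \<open>a1\<close>, and \<open>D\<close> is the derivative of \<open>F\<close> at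
    \<open>p\<close>.\<close>
  define w where "w s = b s * exp (s * p)" for s
  define k1 where "k1 = c1 * exp (a1 * p)"
  define k2 where "k2 = c2 * exp (a2 * p)"
  define u where "u s = (a2 - s) / (a2 - a1)" for s
  define M where "M = (\<Sum>s\<in>B. w s * u s)"
  define D where "D = k1 * a1 + k2 * a2 - (\<Sum>s\<in>B. w s * s)"
  have F0: "F p = 0" and Fnn: "\<And>x. x \<in> X \<Longrightarrow> 0 \<le> F x"
    using eq le by (auto simp: F_def)
  have D: "(F has_real_derivative D) (at p)"
    unfolding F_def D_def k1_def k2_def w_def
    by (auto intro!: derivative_eq_intros sum.cong simp: algebra_simps)
  have w: "0 < w s" and u: "0 < u s" "u s < 1" if "s \<in> B" for s
    using that B(3) b a by (auto simp: w_def u_def field_simps)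
  have k: "0 < k1" "0 < k2" using c by (auto simp: k1_def k2_def)
  have W: "sum w B = k1 + k2" using eq by (simp add: w_def k1_def k2_def)
  have M: "0 < M" unfolding M_def using B w u by (intro sum_pos mult_pos_pos)
  have M': "k1 + k2 - M = (\<Sum>s\<in>B. w s * (1 - u s))"
    unfolding W[symmetric] M_def by (simp add: sum_subtractf algebra_simps)
  have M2: "0 < k1 + k2 - M" unfolding M' using B w u by (intro sum_pos mult_pos_pos) auto
  have "(\<Sum>s\<in>B. w s * s) = (\<Sum>s\<in>B. a2 * w s - (a2 - a1) * (w s * u s))"
  proof (rule sum.cong)
    fix s
    have "(a2 - a1) * u s = a2 - s" using a by (simp add: u_def)
    then show "w s * s = a2 * w s - (a2 - a1) * (w s * u s)" by algebra
  qed simp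
  also have "\<dots> = a2 * (k1 + k2) - (a2 - a1) * M"
    by (simp add: sum_subtractf sum_distrib_left M_def flip: W)
  \<comment> \<open>So the sign of \<open>D\<close> tells whether the barycentric weights give
    \<open>a1\<close> more or less than the available \<open>k1\<close>.\<close>
  finally have DM: "D = (a2 - a1) * (M - k1)" unfolding D_def by algebra
  \<comment> \<open>If \<open>D > 0\<close>, then \<open>F\<close> is negative just left of its zero
    \<open>p\<close>. A point of \<open>X\<close> left of \<open>p\<close> would, by convexity,
    bring such points into \<open>X\<close>.\<close>
  have right: "p \<le> x" if x: "x \<in> X" and D0: "0 < D" for x
  proof (rule ccontr)
    assume "\<not> p \<le> x"
    then have xp: "x < p" by simp
    obtain e where e: "e > 0" "\<And>h. 0 < h \<Longrightarrow> h < e \<Longrightarrow> F (p - h) < F p"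
      using DERIV_pos_inc_left[OF D D0] by blast
    define h where "h = min (e / 2) (p - x)"
    have h: "0 < h" "h < e" "h \<le> p - x" using e xp by (auto simp: h_def)
    have "p - h \<in> X"
      by (rule mem_is_interval_1_I[of X x p]) (use X x h in \<open>auto simp: is_interval_convex_1\<close>)
    with Fnn e(2)[OF h(1,2)] F0 show False by force
  qed
  have left: "x \<le> p" if x: "x \<in> X" and D0: "D < 0" for x
  proof (rule ccontr)
    assume "\<not> x \<le> p"
    then have xp: "p < x" by simp
    obtain e where e: "e > 0" "\<And>h. 0 < h \<Longrightarrow> h < e \<Longrightarrow> F (p + h) < F p"
      using DERIV_neg_dec_right[OF D D0] by blast
    define h where "h = min (e / 2) (x - p)"
    have h: "0 < h" "h < e" "h \<le> x - p" using e xp by (auto simp: h_def)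
    have "p + h \<in> X"
      by (rule mem_is_interval_1_I[of X p x]) (use X x h in \<open>auto simp: is_interval_convex_1\<close>)
    with Fnn e(2)[OF h(1,2)] F0 show False by force
  qed
  \<comment> \<open>\<open>l s\<close> is the share of \<open>w s\<close> given to
    \<open>a1\<close>. The sign condition is that of \<open>exp_le_split\<close> at
    \<open>y = x - p\<close>; the sum condition exhausts \<open>k1\<close>, and by \<open>W\<close>
    the complementary shares then exhaust \<open>k2\<close>.\<close>
  have "\<exists>l. (\<forall>s\<in>B. 0 \<le> l s \<and> l s \<le> 1 \<and> (\<forall>x\<in>X. 0 \<le> (x - p) * (u s - l s))) \<and>
          (\<Sum>s\<in>B. w s * l s) = k1"
  proof (cases "0 \<le> D")
    case True
    then have kM: "k1 \<le> M" using a by (simp add: DM zero_le_mult_iff)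
    \<comment> \<open>The common factor that lowers the total for \<open>a1\<close> from
      \<open>M\<close> to \<open>k1\<close>. For \<open>D = 0\<close> it equals 1, so the sign
      condition holds on both sides of \<open>p\<close>.\<close>
    define \<theta> where "\<theta> = k1 / M"
    have \<theta>: "0 \<le> \<theta>" "\<theta> \<le> 1" using k M kM by (auto simp: \<theta>_def)
    have "0 \<le> \<theta> * u s \<and> \<theta> * u s \<le> 1 \<and> (\<forall>x\<in>X. 0 \<le> (x - p) * (u s - \<theta> * u s))" if s: "s \<in> B" for s
    proof (intro conjI ballI)
      show "0 \<le> \<theta> * u s" using \<theta> u[OF s] by simp
      show "\<theta> * u s \<le> 1" using \<theta> u[OF s] by (intro mult_le_one) auto
      fix x assume x: "x \<in> X"
      show "0 \<le> (x - p) * (u s - \<theta> * u s)"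
      proof (cases "D = 0")
        case True
        then have "\<theta> = 1" using a M by (simp add: DM \<theta>_def)
        then show ?thesis by simp
      next
        case False
        then have "p \<le> x" using \<open>0 \<le> D\<close> right x by simp
        moreover have "\<theta> * u s \<le> u s" using \<theta> u[OF s] by (simp add: mult_left_le_one_le)
        ultimately show ?thesis by simp
      qed
    qed
    moreover have "(\<Sum>s\<in>B. w s * (\<theta> * u s)) = \<theta> * M"
      unfolding M_def sum_distrib_left by (simp add: mult.left_commute)
    moreover have "\<theta> * M = k1" using M by (simp add: \<theta>_def)
    ultimately show ?thesis by (intro exI[of _ "\<lambda>s. \<theta> * u s"]) auto
  next
    case False
    then have D0: "D < 0" by simp
    then have kM: "M < k1" using a by (simp add: DM mult_less_0_iff)
    \<comment> \<open>Mirror image: the shares \<open>1 - u s\<close> of \<open>a2\<close> have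
      total \<open>k1 + k2 - M > k2\<close> and are scaled down to \<open>k2\<close>.\<close>
    define \<theta> where "\<theta> = k2 / (k1 + k2 - M)"
    have \<theta>: "0 \<le> \<theta>" "\<theta> \<le> 1" using k M2 kM by (auto simp: \<theta>_def)
    have "0 \<le> 1 - \<theta> * (1 - u s) \<and> 1 - \<theta> * (1 - u s) \<le> 1 \<and>
        (\<forall>x\<in>X. 0 \<le> (x - p) * (u s - (1 - \<theta> * (1 - u s))))" if s: "s \<in> B" for s
    proof (intro conjI ballI)
      have "\<theta> * (1 - u s) \<le> 1" using \<theta> u[OF s] by (intro mult_le_one) auto
      then show "0 \<le> 1 - \<theta> * (1 - u s)" by simp
      show "1 - \<theta> * (1 - u s) \<le> 1" using \<theta> u[OF s] by simp
      fix x assume x: "x \<in> X"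
      have "\<theta> * (1 - u s) \<le> 1 - u s" using \<theta> u[OF s] by (simp add: mult_left_le_one_le)
      then show "0 \<le> (x - p) * (u s - (1 - \<theta> * (1 - u s)))"
        using left[OF x D0] by (intro mult_nonpos_nonpos) auto
    qed
    moreover have "(\<Sum>s\<in>B. w s * (1 - \<theta> * (1 - u s))) = k1 + k2 - \<theta> * (k1 + k2 - M)"
      unfolding M' unfolding sum_distrib_left W[symmetric] sum_subtractf[symmetric]
      by (rule sum.cong) (auto simp: algebra_simps)
    moreover have "\<theta> * (k1 + k2 - M) = k2" using M2 by (simp add: \<theta>_def)
    ultimately show ?thesis by (intro exI[of _ "\<lambda>s. 1 - \<theta> * (1 - u s)"]) auto
  qed
  then obtain l where l: "\<And>s. s \<in> B \<Longrightarrow> 0 \<le> l s" "\<And>s. s \<in> B \<Longrightarrow> l s \<le> 1"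
    "\<And>s x. s \<in> B \<Longrightarrow> x \<in> X \<Longrightarrow> 0 \<le> (x - p) * (u s - l s)" "(\<Sum>s\<in>B. w s * l s) = k1"
    by blast
  show ?thesis
  \<comment> \<open>The exponential factors undo the translation by \<open>p\<close>.\<close>
  proof (rule that[of "\<lambda>s. w s * l s * exp (- (a1 * p))" "\<lambda>s. w s * (1 - l s) * exp (- (a2 * p))"])
    show "(\<Sum>s\<in>B. w s * l s * exp (- (a1 * p))) = c1"
      by (simp add: l(4) k1_def exp_minus flip: sum_distrib_right)
    have "(\<Sum>s\<in>B. w s * (1 - l s)) = k2"
      using l(4) W by (simp add: right_diff_distrib sum_subtractf)
    then show "(\<Sum>s\<in>B. w s * (1 - l s) * exp (- (a2 * p))) = c2"
      by (simp add: k2_def exp_minus flip: sum_distrib_right)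
  next
    fix s assume s: "s \<in> B"
    show "0 \<le> w s * l s * exp (- (a1 * p))" "0 \<le> w s * (1 - l s) * exp (- (a2 * p))"
      using l(1,2)[OF s] w[OF s] by auto
    fix x assume x: "x \<in> X"
    have "exp (s * (x - p)) \<le> l s * exp (a1 * (x - p)) + (1 - l s) * exp (a2 * (x - p))"
      using B(3)[OF s] l(3)[OF s x] by (intro exp_le_split a) (auto simp: u_def)
    then have "w s * exp (s * (x - p))
        \<le> w s * (l s * exp (a1 * (x - p)) + (1 - l s) * exp (a2 * (x - p)))"
      using w[OF s] by simp
    then show "b s * exp (s * x) \<le> w s * l s * exp (- (a1 * p)) * exp (a1 * x)
        + w s * (1 - l s) * exp (- (a2 * p)) * exp (a2 * x)"
      by (simp add: w_def right_diff_distrib exp_diff exp_minus field_simps)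
  qed
qed

section \<open>The maximum of the quotient and the reduction to the tight case\<close>

lemma tendsto_exp_mult_at_top:
  fixes k :: real assumes "k < 0" shows "((\<lambda>x. exp (k * x)) \<longlongrightarrow> 0) at_top"
  by (rule filterlim_compose[OF exp_at_bot])
    (rule filterlim_tendsto_neg_mult_at_bot[OF tendsto_const assms filterlim_ident])

text \<open>Keeping only the \<open>a2\<close> term of the denominator gives decay at
  \<open>at_top\<close>, as \<open>s < a2\<close>; keeping only the \<open>a1\<close> term gives
  decay at \<open>at_bot\<close>, as \<open>a1 < s\<close>.\<close>

lemma tendsto_exp_div_exps_at_infinity:
  fixes a1 a2 c1 c2 s :: real
  assumes s: "a1 < s" "s < a2" and c: "0 < c1" "0 < c2"
  shows "((\<lambda>x. exp (s * x) / (c1 * exp (a1 * x) + c2 * exp (a2 * x))) \<longlongrightarrow> 0) at_infinity"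
proof -
  let ?r = "\<lambda>x. exp (s * x) / (c1 * exp (a1 * x) + c2 * exp (a2 * x))"
  have le1: "?r x \<le> exp ((a1 - s) * (- x)) / c1" for x
  proof -
    have "?r x \<le> exp (s * x) / (c1 * exp (a1 * x))"
      using c by (intro divide_left_mono) (auto intro!: mult_pos_pos add_pos_pos)
    also have "\<dots> = exp ((a1 - s) * (- x)) / c1"
      by (simp add: left_diff_distrib exp_diff)
    finally show ?thesis .
  qed
  have le2: "?r x \<le> exp ((s - a2) * x) / c2" for x
  proof -
    have "?r x \<le> exp (s * x) / (c2 * exp (a2 * x))"
      using c by (intro divide_left_mono) (auto intro!: mult_pos_pos add_pos_pos)
    also have "\<dots> = exp ((s - a2) * x) / c2"
      by (simp add: left_diff_distrib exp_diff)
    finally show ?thesis .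
  qed
  have nn: "0 \<le> ?r x" for x using c by simp
  have "(?r \<longlongrightarrow> 0) at_top"
  proof (rule tendsto_sandwich[OF _ _ tendsto_const])
    show "((\<lambda>x. exp ((s - a2) * x) / c2) \<longlongrightarrow> 0) at_top"
      using tendsto_divide_zero[OF tendsto_exp_mult_at_top[of "s - a2"]] s by simp
  qed (use nn le2 in auto)
  moreover have "(?r \<longlongrightarrow> 0) at_bot"
  proof (rule tendsto_sandwich[OF _ _ tendsto_const])
    show "((\<lambda>x. exp ((a1 - s) * (- x)) / c1) \<longlongrightarrow> 0) at_bot"
      using s by (intro tendsto_divide_zero
        filterlim_compose[OF tendsto_exp_mult_at_top filterlim_uminus_at_top_at_bot]) simp
  qed (use nn le1 in auto)
  ultimately show ?thesis
    unfolding at_infinity_eq_at_top_bot by (rule filterlim_sup)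
qed

text \<open>Outside a large ball \<open>q\<close> stays below the positive value
  \<open>q x0\<close>, so \<open>x0\<close> lies in the ball and the maximum over the compact part
  of \<open>S\<close> is a maximum over \<open>S\<close>.\<close>

lemma continuous_vanishing_attains_sup:
  fixes q :: "real \<Rightarrow> real"
  assumes S: "closed S" "x0 \<in> S" and q: "continuous_on UNIV q" "(q \<longlongrightarrow> 0) at_infinity" "0 < q x0"
  obtains p where "p \<in> S" "\<And>x. x \<in> S \<Longrightarrow> q x \<le> q p"
proof -
  have "eventually (\<lambda>x. q x < q x0) at_infinity"
    using order_tendstoD(2)[OF q(2,3)] .
  then obtain R where R: "\<And>x. R \<le> norm x \<Longrightarrow> q x < q x0"
    by (auto simp: eventually_at_infinity)
  have x0: "x0 \<in> S \<inter> cball 0 R" using R[of x0] S by force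
  have "compact (S \<inter> cball 0 R)" using S(1) by (simp add: closed_Int_compact)
  then obtain p where p: "p \<in> S \<inter> cball 0 R" "\<And>x. x \<in> S \<inter> cball 0 R \<Longrightarrow> q x \<le> q p"
    using continuous_attains_sup[of "S \<inter> cball 0 R" q] x0 continuous_on_subset[OF q(1)] by blast
  have "q x \<le> q p" if "x \<in> S" for x
  proof (cases "norm x \<le> R")
    case True then show ?thesis using p(2)[of x] that by simp
  next
    case False then show ?thesis using R[of x] p(2)[OF x0] by linarith
  qed
  with p(1) that show ?thesis by blast
qed

lemma sage_decomposition_ordered:
  fixes a1 a2 c1 c2 :: real and b :: "real \<Rightarrow> real" and B X :: "real set"
  assumes a: "a1 < a2" and B: "finite B" "B \<noteq> {}" "\<And>s. s \<in> B \<Longrightarrow> a1 < s \<and> s < a2"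
    and b: "\<And>s. s \<in> B \<Longrightarrow> 0 < b s" and c: "0 < c1" "0 < c2"
    and X: "convex X" "X \<noteq> {}"
    and le: "\<And>x. x \<in> X \<Longrightarrow> (\<Sum>s\<in>B. b s * exp (s * x)) \<le> c1 * exp (a1 * x) + c2 * exp (a2 * x)"
  shows "\<exists>C1 C2. (\<forall>s\<in>B. 0 \<le> C1 s) \<and> (\<forall>s\<in>B. 0 \<le> C2 s) \<and> sum C1 B = c1 \<and> sum C2 B = c2 \<and>
    (\<forall>s\<in>B. \<forall>x\<in>X. b s * exp (s * x) \<le> C1 s * exp (a1 * x) + C2 s * exp (a2 * x))"
proof -
  define l where "l x = c1 * exp (a1 * x) + c2 * exp (a2 * x)" for x
  define h where "h x = (\<Sum>s\<in>B. b s * exp (s * x))" for x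
  define q where "q x = h x / l x" for x
  have lpos: "0 < l x" for x using c by (simp add: l_def add_pos_pos)
  have hpos: "0 < h x" for x using B b by (auto simp: h_def intro!: sum_pos)
  have cont: "continuous_on UNIV h" "continuous_on UNIV l"
    unfolding h_def l_def by (intro continuous_intros)+
  have contq: "continuous_on UNIV q"
    unfolding q_def using cont lpos by (intro continuous_intros) (auto simp: less_imp_neq[symmetric])
  have "((\<lambda>x. \<Sum>s\<in>B. b s * (exp (s * x) / l x)) \<longlongrightarrow> (\<Sum>s\<in>B. b s * 0)) at_infinity"
    unfolding l_def using B(3) c
    by (intro tendsto_sum tendsto_mult tendsto_const tendsto_exp_div_exps_at_infinity) auto
  then have limq: "(q \<longlongrightarrow> 0) at_infinity"
    by (simp add: q_def[abs_def] h_def sum_divide_distrib)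
  obtain x0 where "x0 \<in> closure X" using X(2) closure_subset by blast
  then obtain p where p: "p \<in> closure X" "\<And>x. x \<in> closure X \<Longrightarrow> q x \<le> q p"
    using continuous_vanishing_attains_sup[OF closed_closure _ contq limq] hpos lpos
    by (metis divide_pos_pos q_def)
  have "closure X \<subseteq> {x. h x \<le> l x}"
    using le cont by (intro closure_minimal closed_Collect_le) (auto simp: h_def l_def)
  then have q1: "q p \<le> 1" using p(1) lpos[of p] by (auto simp: q_def)
  have q0: "0 < q p" using hpos lpos by (simp add: q_def)
  have scaled: "(\<Sum>s\<in>B. b s / q p * exp (s * x)) = h x / q p" for x
    by (simp add: h_def sum_divide_distrib)
  obtain C1 C2 where C:
    "\<And>s. s \<in> B \<Longrightarrow> 0 \<le> C1 s" "\<And>s. s \<in> B \<Longrightarrow> 0 \<le> C2 s" "sum C1 B = c1" "sum C2 B = c2"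
    "\<And>s x. s \<in> B \<Longrightarrow> x \<in> closure X \<Longrightarrow>
      b s / q p * exp (s * x) \<le> C1 s * exp (a1 * x) + C2 s * exp (a2 * x)"
  \<comment> \<open>Maximality of \<open>q p\<close> gives \<open>h / q p \<le> l\<close> on the
    closure, with equality at \<open>p\<close>.\<close>
  proof (rule sage_decomposition_tight[OF a B, of "\<lambda>s. b s / q p" c1 c2 "closure X" p])
    show "convex (closure X)" using X(1) by (rule convex_closure)
    show "(\<Sum>s\<in>B. b s / q p * exp (s * x)) \<le> c1 * exp (a1 * x) + c2 * exp (a2 * x)"
      if "x \<in> closure X" for x
      unfolding scaled l_def[symmetric]
      using p(2)[OF that] q0 lpos[of x] by (simp add: q_def[of x] field_simps)
    show "(\<Sum>s\<in>B. b s / q p * exp (s * p)) = c1 * exp (a1 * p) + c2 * exp (a2 * p)"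
      unfolding scaled l_def[symmetric] using hpos[of p] by (simp add: q_def)
  qed (use b q0 c p(1) in auto)
  have "b s * exp (s * x) \<le> C1 s * exp (a1 * x) + C2 s * exp (a2 * x)" if "s \<in> B" "x \<in> X" for s x
  proof -
    \<comment> \<open>As \<open>q p \<le> 1\<close>, the scaling only enlarged the subtracted terms,
      so the same \<open>C1\<close>, \<open>C2\<close> serve for \<open>b\<close>.\<close>
    have "b s \<le> b s / q p" using q0 q1 b[OF that(1)] by (simp add: field_simps)
    then have "b s * exp (s * x) \<le> b s / q p * exp (s * x)" by (rule mult_right_mono) simp
    also have "\<dots> \<le> C1 s * exp (a1 * x) + C2 s * exp (a2 * x)"
      using that closure_subset by (intro C(5)) auto
    finally show ?thesis .
  qed
  with C show ?thesis by blast
qed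

section \<open>Exponents in either order, and membership in the cone\<close>

lemma sage_decomposition:
  fixes a1 a2 c1 c2 :: real and b :: "real \<Rightarrow> real" and B X :: "real set"
  assumes a: "a1 \<noteq> a2" and B: "finite B" "B \<noteq> {}" "B \<subseteq> convex hull {a1, a2} - {a1, a2}"
    and b: "\<And>s. s \<in> B \<Longrightarrow> 0 < b s" and c: "0 < c1" "0 < c2"
    and X: "convex X" "X \<noteq> {}"
    and le: "\<And>x. x \<in> X \<Longrightarrow> (\<Sum>s\<in>B. b s * exp (s * x)) \<le> c1 * exp (a1 * x) + c2 * exp (a2 * x)"
  shows "\<exists>C1 C2. (\<forall>s\<in>B. 0 \<le> C1 s) \<and> (\<forall>s\<in>B. 0 \<le> C2 s) \<and> sum C1 B = c1 \<and> sum C2 B = c2 \<and>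
    (\<forall>s\<in>B. \<forall>x\<in>X. b s * exp (s * x) \<le> C1 s * exp (a1 * x) + C2 s * exp (a2 * x))"
proof (cases "a1 < a2")
  case True
  then have "a1 < s \<and> s < a2" if "s \<in> B" for s
    using B(3) that by (force simp: closed_segment_eq_real_ivl simp flip: segment_convex_hull)
  then show ?thesis using sage_decomposition_ordered[OF True B(1,2) _ b c X le] by blast
next
  case False
  with a have a': "a2 < a1" by simp
  have mid: "a2 < s \<and> s < a1" if "s \<in> B" for s
    using B(3) that a' by (force simp: closed_segment_eq_real_ivl simp flip: segment_convex_hull)
  have le': "(\<Sum>s\<in>B. b s * exp (s * x)) \<le> c2 * exp (a2 * x) + c1 * exp (a1 * x)"
    if "x \<in> X" for x
    using le[OF that] by simp
  obtain C2 C1 where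
    "\<forall>s\<in>B. 0 \<le> C2 s" "\<forall>s\<in>B. 0 \<le> C1 s" "sum C2 B = c2" "sum C1 B = c1"
    "\<forall>s\<in>B. \<forall>x\<in>X. b s * exp (s * x) \<le> C2 s * exp (a2 * x) + C1 s * exp (a1 * x)"
    using sage_decomposition_ordered[OF a' B(1,2) mid b c(2,1) X le'] by blast
  then show ?thesis
    by (intro exI[of _ C1] exI[of _ C2]) (simp add: add.commute)
qed

lemma mem_signed_sage_cone_iff:
  assumes "finite B"
  shows "f \<in> signed_sage_cone X A B \<longleftrightarrow>
    (\<exists>g. f = (\<lambda>x. \<Sum>\<beta>\<in>B. g \<beta> x) \<and> (\<forall>\<beta>\<in>B. g \<beta> \<in> sage_single X A \<beta>))"
proof -
  have "sum g B = (\<lambda>x. \<Sum>\<beta>\<in>B. g \<beta> x)" for g :: "real \<Rightarrow> real \<Rightarrow> real"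
    using assms by (induction B rule: finite_induct) auto
  then show ?thesis
    unfolding signed_sage_cone_def set_sum_alt[OF assms] by auto
qed

theorem theorem3p5:
  fixes \<alpha>1 \<alpha>2 :: real and A B X :: "real set"
    and c d :: "real \<Rightarrow> real" and f :: "real \<Rightarrow> real"
  assumes "A = {\<alpha>1, \<alpha>2}" and "\<alpha>1 \<noteq> \<alpha>2"
    and "finite B" and "B \<noteq> {}" and "B \<subseteq> convex hull A - A"
    and "X \<noteq> {}" and "convex X"
    and "\<forall>\<alpha>\<in>A. 0 < c \<alpha>" and "\<forall>\<beta>\<in>B. d \<beta> < 0"
    and "f = (\<lambda>x. c \<alpha>1 * expfun \<alpha>1 x + c \<alpha>2 * expfun \<alpha>2 x + (\<Sum>\<beta>\<in>B. d \<beta> * expfun \<beta> x))"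
  shows "(nonneg_on X f \<longleftrightarrow>
           (\<exists>(g :: real \<Rightarrow> real \<Rightarrow> real) (C :: real \<Rightarrow> real \<Rightarrow> real).
              f = (\<lambda>x. \<Sum>\<beta>\<in>B. g \<beta> x)
            \<and> (\<forall>\<beta>\<in>B. g \<beta> = (\<lambda>x. (\<Sum>\<alpha>\<in>A. C \<beta> \<alpha> * expfun \<alpha> x) + d \<beta> * expfun \<beta> x))
            \<and> (\<forall>\<beta>\<in>B. \<forall>\<alpha>\<in>A. 0 \<le> C \<beta> \<alpha>)
            \<and> (\<forall>\<beta>\<in>B. nonneg_on X (g \<beta>))))
       \<and> (nonneg_on X f \<longleftrightarrow> f \<in> signed_sage_cone X A B)"
    (is "(?N \<longleftrightarrow> ?D) \<and> (?N \<longleftrightarrow> ?S)")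
proof -
  have ND: ?D if ?N
  proof -
    have "\<exists>C1 C2. (\<forall>s\<in>B. 0 \<le> C1 s) \<and> (\<forall>s\<in>B. 0 \<le> C2 s) \<and> sum C1 B = c \<alpha>1 \<and> sum C2 B = c \<alpha>2 \<and>
      (\<forall>s\<in>B. \<forall>x\<in>X. - d s * exp (s * x) \<le> C1 s * exp (\<alpha>1 * x) + C2 s * exp (\<alpha>2 * x))"
    proof (rule sage_decomposition)
      show "(\<Sum>s\<in>B. - d s * exp (s * x)) \<le> c \<alpha>1 * exp (\<alpha>1 * x) + c \<alpha>2 * exp (\<alpha>2 * x)"
        if "x \<in> X" for x
        using \<open>?N\<close> that by (auto simp: nonneg_on_def assms(10) expfun_def sum_negf)
    qed (use assms in auto)
    then obtain C1 C2 where C: "\<forall>s\<in>B. 0 \<le> C1 s" "\<forall>s\<in>B. 0 \<le> C2 s"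
      "sum C1 B = c \<alpha>1" "sum C2 B = c \<alpha>2"
      "\<forall>s\<in>B. \<forall>x\<in>X. - d s * exp (s * x) \<le> C1 s * exp (\<alpha>1 * x) + C2 s * exp (\<alpha>2 * x)"
      by blast
    \<comment> \<open>The case distinction recovers both coefficients because
      \<open>\<alpha>1 \<noteq> \<alpha>2\<close>.\<close>
    define C where "C s \<alpha> = (if \<alpha> = \<alpha>1 then C1 s else C2 s)" for s \<alpha>
    define g where "g s x = (\<Sum>\<alpha>\<in>A. C s \<alpha> * expfun \<alpha> x) + d s * expfun s x" for s x
    have g: "g s x = C1 s * expfun \<alpha>1 x + C2 s * expfun \<alpha>2 x + d s * expfun s x" for s x
      using assms(2) by (simp add: g_def C_def assms(1))
    have "f = (\<lambda>x. \<Sum>\<beta>\<in>B. g \<beta> x)"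
      unfolding assms(10) g by (simp add: sum.distrib flip: sum_distrib_right C(3,4))
    moreover have "\<forall>\<beta>\<in>B. nonneg_on X (g \<beta>)"
      using C(5) by (force simp: nonneg_on_def g expfun_def)
    moreover have "\<forall>\<beta>\<in>B. \<forall>\<alpha>\<in>A. 0 \<le> C \<beta> \<alpha>"
      using C(1,2) by (simp add: C_def)
    ultimately show ?D
      by (intro exI[of _ g] exI[of _ C]) (auto simp: g_def)
  qed
  have DS: ?S if ?D
    using that unfolding mem_signed_sage_cone_iff[OF assms(3)] sage_single_def by blast
  \<comment> \<open>Sums of functions nonnegative on \<open>X\<close> are nonnegative on
    \<open>X\<close>, whatever coefficients the cone decomposition has; this closes the cycle of
    implications.\<close>
  have SN: ?N if ?S
    using that unfolding mem_signed_sage_cone_iff[OF assms(3)] sage_single_def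
    by (auto simp: nonneg_on_def intro!: sum_nonneg)
  from ND DS SN show ?thesis by blast
qed

end
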